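(* Let $b\ge 2$ be an integer and let $x=0.a_1a_2a_3\cdots$ (base-$b$ expansion, digits $a_j\in\{0,1,\dots,b-1\}$) be normal to base $b$. Let $n_1\in\mathbb{N}$ be arbitrary and define the sequence $(n_i)_{i\ge1}$ recursively by \[ n_{i+1}=n_i+1+a_{n_i},\qquad i\ge 1 . \] Then the number $0.a_{n_1}a_{n_2}a_{n_3}\cdots$ is normal to base $b$.
   Context: For an integer base $b\ge 2$, a number with base-$b$ digit sequence $0.d_1d_2d_3\cdots$ ($d_j\in\{0,\dots,b-1\}$) is normal to base $b$ if for every $k\ge1$ and every finite string $[c_1,\dots,c_k]$ of base-$b$ digits, \[ \lim_{n\to\infty}\frac{\#\{0\le i\le n-1:\ d_{i+j}=c_j \text{ for } 1\le j\le k\}}{n}=\frac{1}{b^k}. \] *)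

theory Defs
  imports "HOL-Analysis.Analysis"
begin

(* Digit sequences are indexed from 1, so the value at index 0 is irrelevant throughout. *)

definition digit_seq :: "nat \<Rightarrow> (nat \<Rightarrow> nat) \<Rightarrow> bool" where
  "digit_seq b d \<longleftrightarrow> (\<forall>j\<ge>1. d j < b)"

definition radix_value :: "nat \<Rightarrow> (nat \<Rightarrow> nat) \<Rightarrow> real" where
  "radix_value b d = (\<Sum>j. real (d (Suc j)) / real b ^ Suc j)"

definition occurrences :: "(nat \<Rightarrow> nat) \<Rightarrow> nat \<Rightarrow> (nat \<Rightarrow> nat) \<Rightarrow> nat \<Rightarrow> nat" where
  "occurrences d k c n = card {i. i < n \<and> (\<forall>j\<in>{1..k}. d (i + j) = c j)}"

definition normal_digits :: "nat \<Rightarrow> (nat \<Rightarrow> nat) \<Rightarrow> bool" where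
  "normal_digits b d \<longleftrightarrow>
     (\<forall>k\<ge>1. \<forall>c. (\<forall>j\<in>{1..k}. c j < b) \<longrightarrow>
        (\<lambda>n. real (occurrences d k c n) / real n) \<longlonglongrightarrow> 1 / real b ^ k)"

(* A number with two base-b expansions has no normal expansion (both are eventually
   constant), so asking for some normal expansion is independent of the choice. *)
definition normal_to_base :: "nat \<Rightarrow> real \<Rightarrow> bool" where
  "normal_to_base b y \<longleftrightarrow>
     (\<exists>d. digit_seq b d \<and> y = radix_value b d \<and> normal_digits b d)"

end

theory Submission
  imports Defs
begin

text \<open>
  The selection is performed by a finite automaton that counts down the digits still to be skipped
  and remembers the last \<open>k\<close> selected digits; whether the next digit is selected is decided before
  it is read. So it suffices (as in Agafonov's theorem) that a functional \<open>g\<close> of state and next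
  digit, with mean zero in every state, averages to zero along a normal sequence. Over uniformly
  random words of length \<open>L\<close> the increments of such a functional are orthogonal, hence its sum
  over a word is typically of order \<open>\<surd>L\<close>, whatever the initial state. Normality transfers this
  estimate to the windows of length \<open>L\<close> of the sequence, and every position lies in \<open>L\<close> windows
  up to a bounded boundary error, so the average of \<open>g\<close> is at most of order \<open>1 / \<surd>L\<close>.
  Finally, a normal expansion is not eventually constant, so it is the only expansion of its
  value and the given digits \<open>a\<close> are normal themselves.
\<close>

section \<open>Uniqueness of normal expansions\<close>

lemma radix_summable:
  assumes "b \<ge> 2" "digit_seq b d"
  shows "summable (\<lambda>j. real (d (Suc j)) / real b ^ Suc j)"
proof (rule summable_comparison_test')
  show "summable (\<lambda>j. (1 / real b) ^ j)"
    using assms(1) by (intro summable_geometric) simp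
next
  fix j :: nat assume "j \<ge> 0"
  have "real (d (Suc j)) \<le> real b"
    using assms(2) by (simp add: digit_seq_def less_imp_le)
  then show "norm (real (d (Suc j)) / real b ^ Suc j) \<le> (1 / real b) ^ j"
    using assms(1) by (simp add: field_simps)
qed

lemma radix_value_rec:
  assumes "b \<ge> 2" "digit_seq b d"
  shows "radix_value b d = (real (d 1) + radix_value b (\<lambda>i. d (Suc i))) / real b"
proof -
  let ?f = "\<lambda>j. real (d (Suc j)) / real b ^ Suc j"
  have ds: "digit_seq b (\<lambda>i. d (Suc i))"
    using assms(2) by (simp add: digit_seq_def)
  have "(\<Sum>j. ?f j) = (\<Sum>j. ?f (Suc j)) + ?f 0"
    using suminf_split_head[OF radix_summable[OF assms]] by simp
  also have "(\<lambda>j. ?f (Suc j)) = (\<lambda>j. real (d (Suc (Suc j))) / real b ^ Suc j / real b)"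
    by (simp add: field_simps)
  also have "(\<Sum>j. real (d (Suc (Suc j))) / real b ^ Suc j / real b)
    = (\<Sum>j. real (d (Suc (Suc j))) / real b ^ Suc j) / real b"
    using suminf_divide[OF radix_summable[OF assms(1) ds]] by simp
  finally show ?thesis
    by (simp add: radix_value_def add_divide_distrib)
qed

lemma radix_value_bounds:
  assumes "b \<ge> 2" "digit_seq b d"
  shows "0 \<le> radix_value b d" "radix_value b d \<le> 1"
proof -
  show "0 \<le> radix_value b d"
    unfolding radix_value_def by (intro suminf_nonneg radix_summable[OF assms]) simp
  \<comment> \<open>This prepares the comparison series: the expansion with all digits
    \<open>b - 1\<close> has value 1 and dominates \<open>d\<close> term by term.\<close>
  have geo: "(\<lambda>j. (1 / real b) ^ j) sums (1 / (1 - 1 / real b))"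
    using assms(1) by (intro geometric_sums) simp
  have "(\<lambda>j. (1 / real b) ^ j * ((real b - 1) / real b))
      sums (1 / (1 - 1 / real b) * ((real b - 1) / real b))"
    by (rule sums_mult2[OF geo])
  moreover have "1 / (1 - 1 / real b) * ((real b - 1) / real b) = 1"
    using assms(1) by (simp add: field_simps)
  ultimately have s: "(\<lambda>j. (1 / real b) ^ j * ((real b - 1) / real b)) sums 1"
    by metis
  have "radix_value b d \<le> (\<Sum>j. (1 / real b) ^ j * ((real b - 1) / real b))"
    unfolding radix_value_def
  proof (intro suminf_le radix_summable[OF assms] sums_summable[OF s])
    fix j
    have "d (Suc j) < b" using assms(2) by (simp add: digit_seq_def)
    then have "real (d (Suc j)) \<le> real b - 1" by linarith
    then have "real (d (Suc j)) / real b ^ Suc j \<le> (real b - 1) / real b ^ Suc j"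
      by (intro divide_right_mono) auto
    then show "real (d (Suc j)) / real b ^ Suc j \<le> (1 / real b) ^ j * ((real b - 1) / real b)"
      by (simp add: power_divide mult.commute)
  qed
  then show "radix_value b d \<le> 1" using sums_unique[OF s] by simp
qed

text \<open>In \<open>b = d 1 + tail\<close> the digit is at most \<open>b - 1\<close> and the tail
  at most 1, so both are extremal. The tail has value 1 again, and induction applies.\<close>

lemma radix_value_eq_1_digits:
  assumes "b \<ge> 2" "digit_seq b d" "radix_value b d = 1"
  shows "d (Suc i) = b - 1"
proof -
  have first: "f 1 = b - 1 \<and> radix_value b (\<lambda>i. f (Suc i)) = 1"
    if f: "digit_seq b f" "radix_value b f = 1" for f
  proof -
    have "real b = real (f 1) + radix_value b (\<lambda>i. f (Suc i))"
      using radix_value_rec[OF assms(1) f(1)] f(2) assms(1) by (simp add: field_simps)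
    moreover have "radix_value b (\<lambda>i. f (Suc i)) \<le> 1"
      using f(1) by (intro radix_value_bounds(2) assms(1)) (simp add: digit_seq_def)
    moreover have "f 1 < b" using f(1) by (simp add: digit_seq_def)
    moreover from this have "real (f 1) \<le> real b - 1" by linarith
    ultimately show ?thesis by linarith
  qed
  show ?thesis
    using assms(2,3)
  proof (induction i arbitrary: d)
    case 0
    then show ?case using first by simp
  next
    case (Suc i)
    then show ?case
      using first[of d] Suc.IH[of "\<lambda>i. d (Suc i)"] by (simp add: digit_seq_def)
  qed
qed

lemma radix_value_eq_0_digits:
  assumes "b \<ge> 2" "digit_seq b d" "radix_value b d = 0"
  shows "d (Suc i) = 0"
proof -
  have "(\<Sum>j. real (d (Suc j)) / real b ^ Suc j) = 0"
    using assms(3) by (simp add: radix_value_def)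
  then have "\<forall>j. real (d (Suc j)) / real b ^ Suc j = 0"
    using suminf_eq_zero_iff[OF radix_summable[OF assms(1,2)]] by simp
  then show ?thesis using assms(1) by simp
qed

text \<open>A digit other than \<open>e\<close> could start at no more than \<open>m\<close>
  positions, so its frequency would be 0 and not \<open>1 / b\<close>.\<close>

lemma normal_not_eventually_constant:
  assumes "b \<ge> 2" "normal_digits b d"
  shows "\<not> (\<forall>i. d (m + Suc i) = e)"
proof
  assume const: "\<forall>i. d (m + Suc i) = e"
  define v where "v = (if e = 0 then 1 else 0 :: nat)"
  have "v \<noteq> e" "v < b" using assms(1) by (auto simp: v_def)
  then have lim: "(\<lambda>n. real (occurrences d 1 (\<lambda>_. v) n) / real n) \<longlonglongrightarrow> 1 / real b"
    using assms(2)[unfolded normal_digits_def, rule_format, of 1 "\<lambda>_. v"] by simp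
  have bound: "occurrences d 1 (\<lambda>_. v) n \<le> m" for n
  proof -
    have "{i. i < n \<and> (\<forall>j\<in>{1..1}. d (i + j) = v)} \<subseteq> {..<m}"
    proof
      fix i assume "i \<in> {i. i < n \<and> (\<forall>j\<in>{1..1}. d (i + j) = v)}"
      then have "d (Suc i) = v" by simp
      then show "i \<in> {..<m}"
        using const[rule_format, of "i - m"] \<open>v \<noteq> e\<close> by (cases "i < m") auto
    qed
    from card_mono[OF _ this] show ?thesis by (simp add: occurrences_def)
  qed
  have "(\<lambda>n. real m / real n) \<longlonglongrightarrow> 0" by (rule lim_const_over_n)
  then have "(\<lambda>n. real (occurrences d 1 (\<lambda>_. v) n) / real n) \<longlonglongrightarrow> 0"
    by (rule Lim_null_comparison[rotated])
      (use bound in \<open>auto intro!: always_eventually divide_right_mono\<close>)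
  from LIMSEQ_unique[OF this lim] assms(1) show False by simp
qed

text \<open>At the first differing digit the tails differ by a nonzero integer. Both lie in the unit
  interval, so the tail of \<open>d\<close> has value 0 or 1 and is constantly 0 or
  \<open>b - 1\<close>, which normality excludes.\<close>

lemma normal_expansion_unique:
  assumes "b \<ge> 2" "digit_seq b a" "digit_seq b d" "normal_digits b d"
    and "radix_value b a = radix_value b d"
  shows "a (Suc i) = d (Suc i)"
proof (rule ccontr)
  assume ne: "a (Suc i) \<noteq> d (Suc i)"
  have ds: "digit_seq b (\<lambda>j. f (m + j))" if "digit_seq b f" for f m
    using that by (simp add: digit_seq_def)
  define V where "V f m = radix_value b (\<lambda>j. f (m + j))" for f m
  have rec: "real b * V f m = real (f (Suc m)) + V f (Suc m)" if "digit_seq b f" for f m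
    using radix_value_rec[OF assms(1) ds[OF that, of m]] assms(1)
    by (simp add: V_def field_simps)
  have bnd: "0 \<le> V f m" "V f m \<le> 1" if "digit_seq b f" for f m
    using radix_value_bounds[OF assms(1) ds[OF that]] by (auto simp: V_def)
  define m where "m = (LEAST i. a (Suc i) \<noteq> d (Suc i))"
  have m: "a (Suc m) \<noteq> d (Suc m)" unfolding m_def by (rule LeastI[of _ i]) (rule ne)
  have eq: "a (Suc j) = d (Suc j)" if "j < m" for j
    using not_less_Least[of j "\<lambda>i. a (Suc i) \<noteq> d (Suc i)"] that by (simp add: m_def)
  have "V a j = V d j" if "j \<le> m" for j
    using that
  proof (induction j)
    case 0
    then show ?case using assms(5) by (simp add: V_def)
  next
    case (Suc j)
    then show ?case using rec[OF assms(2), of j] rec[OF assms(3), of j] eq[of j] by simp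
  qed
  then have key: "real (a (Suc m)) + V a (Suc m) = real (d (Suc m)) + V d (Suc m)"
    using rec[OF assms(2), of m] rec[OF assms(3), of m] by simp
  consider "a (Suc m) < d (Suc m)" | "a (Suc m) > d (Suc m)" using m by linarith
  then show False
  proof cases
    case 1
    then have "real (a (Suc m)) + 1 \<le> real (d (Suc m))" by linarith
    then have "V d (Suc m) = 0"
      using key bnd(2)[OF assms(2), of "Suc m"] bnd(1)[OF assms(3), of "Suc m"] by linarith
    then have "\<forall>i. d (Suc m + Suc i) = 0"
      using radix_value_eq_0_digits[OF assms(1) ds[OF assms(3), of "Suc m"]] by (simp add: V_def)
    then show False using normal_not_eventually_constant[OF assms(1,4)] by blast
  next
    case 2
    then have "real (d (Suc m)) + 1 \<le> real (a (Suc m))" by linarith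
    then have "V d (Suc m) = 1"
      using key bnd(1)[OF assms(2), of "Suc m"] bnd(2)[OF assms(3), of "Suc m"] by linarith
    then have "\<forall>i. d (Suc m + Suc i) = b - 1"
      using radix_value_eq_1_digits[OF assms(1) ds[OF assms(3), of "Suc m"]] by (simp add: V_def)
    then show False using normal_not_eventually_constant[OF assms(1,4)] by blast
  qed
qed

section \<open>Word frequencies\<close>

definition words :: "nat \<Rightarrow> nat \<Rightarrow> nat list set" where
  "words b L = {w. set w \<subseteq> {..<b} \<and> length w = L}"

text \<open>Normality with digits indexed from 0 and windows taken as lists, so that averages over
  windows become averages over \<open>words b L\<close>. The empty word is included.\<close>

definition word_frequencies :: "nat \<Rightarrow> (nat \<Rightarrow> nat) \<Rightarrow> bool" where
  "word_frequencies b u \<longleftrightarrow> (\<forall>L. \<forall>w\<in>words b L.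
     (\<lambda>N. real (card {m. m < N \<and> map u [m..<m + L] = w}) / real N) \<longlonglongrightarrow> 1 / real b ^ L)"

lemma real_over_self_tendsto_1: "(\<lambda>N. real N / real N) \<longlonglongrightarrow> 1"
  by (rule tendsto_eventually) (auto intro: eventually_sequentiallyI[of 1])

lemma finite_words [simp]: "finite (words b L)"
  unfolding words_def by (rule finite_lists_length_eq) simp

lemma card_words: "card (words b L) = b ^ L"
  unfolding words_def by (subst card_lists_length_eq) auto

lemma words_0 [simp]: "words b 0 = {[]}"
  by (auto simp: words_def)

lemma sum_words_Suc:
  "(\<Sum>w\<in>words b (Suc L). f w) = (\<Sum>d<b. \<Sum>w\<in>words b L. f (d # w))"
proof -
  have "words b (Suc L) = (\<lambda>(d, w). d # w) ` ({..<b} \<times> words b L)"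
    by (force simp: words_def length_Suc_conv image_iff)
  moreover have "inj_on (\<lambda>(d, w). d # w) ({..<b} \<times> words b L)"
    by (auto simp: inj_on_def)
  ultimately show ?thesis
    by (simp add: sum.reindex sum.cartesian_product case_prod_unfold)
qed

lemma occurrences_eq_card_windows:
  "occurrences d k c N
    = card {m. m < N \<and> map (\<lambda>i. d (Suc i)) [m..<m + k] = map (\<lambda>j. c (Suc j)) [0..<k]}"
proof -
  have "(\<forall>j\<in>{1..k}. d (m + j) = c j)
      \<longleftrightarrow> map (\<lambda>i. d (Suc i)) [m..<m + k] = map (\<lambda>j. c (Suc j)) [0..<k]" for m
  proof -
    have "(\<forall>j\<in>{1..k}. d (m + j) = c j) \<longleftrightarrow> (\<forall>j<k. d (Suc (m + j)) = c (Suc j))"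
    proof (intro iffI)
      assume *: "\<forall>j\<in>{1..k}. d (m + j) = c j"
      show "\<forall>j<k. d (Suc (m + j)) = c (Suc j)"
      proof (intro allI impI)
        fix j assume "j < k"
        then show "d (Suc (m + j)) = c (Suc j)" using *[rule_format, of "Suc j"] by simp
      qed
    next
      assume *: "\<forall>j<k. d (Suc (m + j)) = c (Suc j)"
      show "\<forall>j\<in>{1..k}. d (m + j) = c j"
      proof
        fix j assume "j \<in> {1..k}"
        then show "d (m + j) = c j" using *[rule_format, of "j - 1"] by (cases j) auto
      qed
    qed
    then show ?thesis by (simp add: list_eq_iff_nth_eq)
  qed
  then show ?thesis by (simp add: occurrences_def)
qed

lemma normal_digits_iff_word_frequencies:
  "normal_digits b d \<longleftrightarrow> word_frequencies b (\<lambda>i. d (Suc i))"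
proof
  assume *: "normal_digits b d"
  show "word_frequencies b (\<lambda>i. d (Suc i))"
    unfolding word_frequencies_def
  proof (intro allI ballI)
    fix L w assume w: "w \<in> words b L"
    show "(\<lambda>N. real (card {m. m < N \<and> map (\<lambda>i. d (Suc i)) [m..<m + L] = w}) / real N)
      \<longlonglongrightarrow> 1 / real b ^ L"
    proof (cases "L = 0")
      case True
      show ?thesis using real_over_self_tendsto_1 True w by simp
    next
      case False
      define c where "c j = w ! (j - 1)" for j
      have "\<forall>j\<in>{1..L}. c j < b"
      proof
        fix j assume "j \<in> {1..L}"
        then have "w ! (j - 1) \<in> set w" using w by (auto simp: words_def intro!: nth_mem)
        then show "c j < b" using w by (auto simp: words_def c_def)
      qed
      then have "(\<lambda>n. real (occurrences d L c n) / real n) \<longlonglongrightarrow> 1 / real b ^ L"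
        using * False by (simp add: normal_digits_def)
      moreover have "map (\<lambda>j. c (Suc j)) [0..<L] = w"
        using w by (auto simp: words_def c_def map_nth)
      ultimately show ?thesis by (simp add: occurrences_eq_card_windows)
    qed
  qed
next
  assume *: "word_frequencies b (\<lambda>i. d (Suc i))"
  show "normal_digits b d"
    unfolding normal_digits_def
  proof (intro allI impI)
    fix k :: nat and c :: "nat \<Rightarrow> nat"
    assume "k \<ge> 1" and c: "\<forall>j\<in>{1..k}. c j < b"
    have "map (\<lambda>j. c (Suc j)) [0..<k] \<in> words b k"
      using c by (auto simp: words_def)
    with * show "(\<lambda>n. real (occurrences d k c n) / real n) \<longlonglongrightarrow> 1 / real b ^ k"
      by (simp add: word_frequencies_def occurrences_eq_card_windows)
  qed
qed

text \<open>Time average equals space average: grouping the windows by the word they show leaves a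
  finite sum of word frequencies.\<close>

lemma window_average:
  fixes F :: "nat list \<Rightarrow> real"
  assumes "word_frequencies b u" "\<And>i. u i < b"
  shows "(\<lambda>N. (\<Sum>m<N. F (map u [m..<m + L])) / real N)
    \<longlonglongrightarrow> (\<Sum>w\<in>words b L. F w) / real b ^ L"
proof -
  have in_words: "map u [m..<m + L] \<in> words b L" for m
    using assms(2) by (auto simp: words_def)
  have "(\<Sum>m<N. F (map u [m..<m + L])) / real N
    = (\<Sum>w\<in>words b L. F w * (real (card {m. m < N \<and> map u [m..<m + L] = w}) / real N))" for N
  proof -
    have "(\<Sum>m<N. F (map u [m..<m + L]))
      = (\<Sum>w\<in>words b L. \<Sum>m\<in>{m\<in>{..<N}. map u [m..<m + L] = w}. F (map u [m..<m + L]))"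
      by (rule sum.group[symmetric]) (use in_words in auto)
    also have "\<dots> = (\<Sum>w\<in>words b L. F w * real (card {m. m < N \<and> map u [m..<m + L] = w}))"
      by (rule sum.cong) (auto simp: mult.commute)
    finally show ?thesis by (simp add: sum_divide_distrib)
  qed
  moreover have "(\<lambda>N. \<Sum>w\<in>words b L.
      F w * (real (card {m. m < N \<and> map u [m..<m + L] = w}) / real N))
    \<longlonglongrightarrow> (\<Sum>w\<in>words b L. F w * (1 / real b ^ L))"
    using assms(1) by (intro tendsto_sum tendsto_mult tendsto_const) (simp add: word_frequencies_def)
  ultimately show ?thesis by (simp add: sum_divide_distrib)
qed

section \<open>Centred functionals of a finite automaton\<close>

primrec run :: "('q \<Rightarrow> nat \<Rightarrow> 'q) \<Rightarrow> (nat \<Rightarrow> nat) \<Rightarrow> 'q \<Rightarrow> nat \<Rightarrow> 'q" where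
  "run \<delta> u q 0 = q"
| "run \<delta> u q (Suc m) = \<delta> (run \<delta> u q m) (u m)"

text \<open>The gain along a word from a given starting state, detached from the sequence
  \<open>u\<close> so that it can be averaged over all words.\<close>

primrec word_sum :: "('q \<Rightarrow> nat \<Rightarrow> 'q) \<Rightarrow> ('q \<Rightarrow> nat \<Rightarrow> real) \<Rightarrow> nat list \<Rightarrow> 'q \<Rightarrow> real" where
  "word_sum \<delta> g [] q = 0"
| "word_sum \<delta> g (d # w) q = g q d + word_sum \<delta> g w (\<delta> q d)"

lemma word_sum_window:
  "word_sum \<delta> g (map u [m..<m + L]) (run \<delta> u q m)
    = (\<Sum>l<L. g (run \<delta> u q (m + l)) (u (m + l)))"
proof (induction L arbitrary: m)
  case (Suc L)
  have "[m..<m + Suc L] = m # [Suc m..<Suc m + L]"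
    by (simp add: upt_conv_Cons)
  then show ?case
    using Suc[of "Suc m"] by (simp add: sum.lessThan_Suc_shift del: upt_Suc sum.lessThan_Suc)
qed simp

lemma run_in:
  assumes "q \<in> Q" "\<And>q d. q \<in> Q \<Longrightarrow> d < b \<Longrightarrow> \<delta> q d \<in> Q" "\<And>i. u i < b"
  shows "run \<delta> u q m \<in> Q"
  by (induction m) (use assms in auto)

text \<open>Each first digit \<open>d\<close> is followed by \<open>b ^ L\<close> words, so
  \<open>g q d\<close> enters with equal weight for all \<open>d\<close> and cancels; the rest
  cancels by induction from the state \<open>\<delta> q d\<close>.\<close>

lemma sum_word_sum_eq_0:
  assumes "\<And>q d. q \<in> Q \<Longrightarrow> d < b \<Longrightarrow> \<delta> q d \<in> Q"
    and "\<And>q. q \<in> Q \<Longrightarrow> (\<Sum>d<b. g q d) = 0"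
    and "q \<in> Q"
  shows "(\<Sum>w\<in>words b L. word_sum \<delta> g w q) = 0"
  using assms(3)
proof (induction L arbitrary: q)
  case (Suc L)
  have "(\<Sum>w\<in>words b (Suc L). word_sum \<delta> g w q) = (\<Sum>d<b. real (b ^ L) * g q d)"
    using Suc assms(1) by (simp add: sum_words_Suc sum.distrib card_words)
  also have "\<dots> = 0"
    using assms(2)[OF Suc.prems] by (simp flip: sum_distrib_left)
  finally show ?case .
qed simp

text \<open>The increments are orthogonal, because every state has mean increment zero.\<close>

lemma sum_word_sum_square_le:
  assumes "\<And>q d. q \<in> Q \<Longrightarrow> d < b \<Longrightarrow> \<delta> q d \<in> Q"
    and "\<And>q. q \<in> Q \<Longrightarrow> (\<Sum>d<b. g q d) = 0"
    and "\<And>q d. q \<in> Q \<Longrightarrow> d < b \<Longrightarrow> \<bar>g q d\<bar> \<le> 1"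
    and "q \<in> Q"
  shows "(\<Sum>w\<in>words b L. (word_sum \<delta> g w q)\<^sup>2) \<le> real L * real b ^ L"
  using assms(4)
proof (induction L arbitrary: q)
  case (Suc L)
  have "(\<Sum>w\<in>words b L. (word_sum \<delta> g (d # w) q)\<^sup>2) \<le> real b ^ L + real L * real b ^ L"
    if d: "d < b" for d
  proof -
    have "(\<Sum>w\<in>words b L. (word_sum \<delta> g (d # w) q)\<^sup>2)
      = (\<Sum>w\<in>words b L. (g q d)\<^sup>2 + 2 * g q d * word_sum \<delta> g w (\<delta> q d)
          + (word_sum \<delta> g w (\<delta> q d))\<^sup>2)"
      by (simp add: power2_eq_square algebra_simps)
    \<comment> \<open>The cross term disappears because the remaining word sum has mean zero from
      the state \<open>\<delta> q d\<close>.\<close>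
    also have "\<dots> = real b ^ L * (g q d)\<^sup>2 + (\<Sum>w\<in>words b L. (word_sum \<delta> g w (\<delta> q d))\<^sup>2)"
      using sum_word_sum_eq_0[where Q = Q, OF assms(1,2) assms(1)[OF Suc.prems d]]
      by (simp add: sum.distrib card_words flip: sum_distrib_left)
    also have "\<dots> \<le> real b ^ L * 1 + real L * real b ^ L"
      using Suc.IH[OF assms(1)[OF Suc.prems d]] assms(3)[OF Suc.prems d]
      by (intro add_mono mult_left_mono) (auto simp: abs_square_le_1)
    finally show ?thesis by simp
  qed
  then have "(\<Sum>w\<in>words b (Suc L). (word_sum \<delta> g w q)\<^sup>2)
      \<le> (\<Sum>d<b. real b ^ L + real L * real b ^ L)"
    unfolding sum_words_Suc by (intro sum_mono) simp
  then show ?case by (simp add: algebra_simps)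
qed simp

text \<open>Passes from second to first moments by
  \<open>2 * p * \<bar>s\<bar> \<le> s\<^sup>2 + p\<^sup>2\<close>, which is sharp at the typical
  size \<open>p\<close> of the sum. Taking a square as word length avoids roots.\<close>

lemma sum_abs_word_sum_le:
  assumes "\<And>q d. q \<in> Q \<Longrightarrow> d < b \<Longrightarrow> \<delta> q d \<in> Q"
    and "\<And>q. q \<in> Q \<Longrightarrow> (\<Sum>d<b. g q d) = 0"
    and "\<And>q d. q \<in> Q \<Longrightarrow> d < b \<Longrightarrow> \<bar>g q d\<bar> \<le> 1"
    and "q \<in> Q" and "p > 0"
  shows "(\<Sum>w\<in>words b (p\<^sup>2). \<bar>word_sum \<delta> g w q\<bar>) \<le> real p * real b ^ p\<^sup>2"
proof -
  have *: "\<bar>s\<bar> \<le> s\<^sup>2 / (2 * real p) + real p / 2" for s :: real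
  proof -
    have "0 \<le> (\<bar>s\<bar> - real p)\<^sup>2" by simp
    then have "2 * real p * \<bar>s\<bar> \<le> s\<^sup>2 + (real p)\<^sup>2" by (simp add: power2_diff algebra_simps)
    then show ?thesis using assms(5) by (simp add: field_simps power2_eq_square)
  qed
  have "(\<Sum>w\<in>words b (p\<^sup>2). \<bar>word_sum \<delta> g w q\<bar>)
      \<le> (\<Sum>w\<in>words b (p\<^sup>2). (word_sum \<delta> g w q)\<^sup>2 / (2 * real p) + real p / 2)"
    by (intro sum_mono *)
  also have "\<dots> = (\<Sum>w\<in>words b (p\<^sup>2). (word_sum \<delta> g w q)\<^sup>2) / (2 * real p)
      + real b ^ p\<^sup>2 * (real p / 2)"
    by (simp add: sum.distrib card_words sum_divide_distrib)
  also have "\<dots> \<le> real (p\<^sup>2) * real b ^ p\<^sup>2 / (2 * real p) + real b ^ p\<^sup>2 * (real p / 2)"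
    by (intro add_mono divide_right_mono sum_word_sum_square_le[where Q = Q] assms order_refl) auto
  also have "\<dots> = real p * real b ^ p\<^sup>2"
    using assms(5) by (simp add: power2_eq_square field_simps)
  finally show ?thesis .
qed

text \<open>A shift by one exchanges one boundary term for another, at a cost of at most 2.\<close>

lemma shifted_sum_diff_le:
  fixes D :: "nat \<Rightarrow> real"
  assumes "\<And>m. \<bar>D m\<bar> \<le> 1"
  shows "\<bar>(\<Sum>m<N. D (m + l)) - (\<Sum>m<N. D m)\<bar> \<le> 2 * real l"
proof (induction l)
  case (Suc l)
  have "(\<Sum>m<N. D (m + Suc l)) - (\<Sum>m<N. D (m + l)) = D (N + l) - D l"
    using sum_lessThan_telescope[of "\<lambda>m. D (m + l)" N] by (simp add: sum_subtractf)
  then show ?case using Suc assms[of "N + l"] assms[of l] by simp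
qed simp

lemma centred_automaton_average:
  assumes freq: "word_frequencies b u" and u: "\<And>i. u i < b"
    and "finite Q" "q \<in> Q"
    and step: "\<And>q d. q \<in> Q \<Longrightarrow> d < b \<Longrightarrow> \<delta> q d \<in> Q"
    and mean: "\<And>q. q \<in> Q \<Longrightarrow> (\<Sum>d<b. g q d) = 0"
    and bnd: "\<And>q d. q \<in> Q \<Longrightarrow> d < b \<Longrightarrow> \<bar>g q d\<bar> \<le> 1"
  shows "(\<lambda>N. (\<Sum>m<N. g (run \<delta> u q m) (u m)) / real N) \<longlonglongrightarrow> 0"
proof (rule LIMSEQ_I)
  fix r :: real assume "r > 0"
  define D where "D m = g (run \<delta> u q m) (u m)" for m
  \<comment> \<open>The added 1 gives room for a strict bound on the limit, which then holds
    eventually for the averages.\<close>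
  define K where "K = real (card Q) + 1"
  have run_Q: "run \<delta> u q m \<in> Q" for m
    by (rule run_in[where b = b]) (use assms in auto)
  have D1: "\<bar>D m\<bar> \<le> 1" for m
    unfolding D_def by (intro bnd run_Q u)
  have b0: "b > 0" using u[of 0] by simp
  \<comment> \<open>With windows of length \<open>p\<^sup>2\<close> the main error is
    \<open>K * p / p\<^sup>2 = K / p\<close>, which is now below \<open>r / 2\<close>.\<close>
  obtain p :: nat where p: "real p > 2 * K / r" using reals_Archimedean2 by blast
  have "K > 0" by (simp add: K_def)
  then have p0: "p > 0" using p \<open>r > 0\<close> by (auto intro!: Nat.gr0I simp: field_simps)
  define L where "L = p\<^sup>2"
  have L0: "L > 0" using p0 by (simp add: L_def)
  \<comment> \<open>Summing over all states covers whichever state the run has on entering a window,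
    so the bound depends on the window alone and \<open>window_average\<close> applies.\<close>
  define F where "F w = (\<Sum>q\<in>Q. \<bar>word_sum \<delta> g w q\<bar>)" for w
  have "(\<Sum>w\<in>words b L. F w) = (\<Sum>q\<in>Q. \<Sum>w\<in>words b L. \<bar>word_sum \<delta> g w q\<bar>)"
    unfolding F_def by (rule sum.swap)
  also have "\<dots> \<le> (\<Sum>q\<in>Q. real p * real b ^ L)"
    unfolding L_def by (intro sum_mono sum_abs_word_sum_le[where Q = Q] step mean bnd p0)
  finally have "(\<Sum>w\<in>words b L. F w) / real b ^ L \<le> real (card Q) * real p"
    using b0 by (simp add: field_simps)
  also have "\<dots> < K * real p" using p0 by (simp add: K_def)
  finally have "eventually (\<lambda>N. (\<Sum>m<N. F (map u [m..<m + L])) / real N < K * real p) sequentially"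
    by (intro order_tendstoD(2)[OF window_average[OF freq u]])
  then obtain N1 where N1: "\<And>N. N \<ge> N1 \<Longrightarrow>
      (\<Sum>m<N. F (map u [m..<m + L])) / real N < K * real p"
    by (auto simp: eventually_sequentially)
  \<comment> \<open>The boundary error per position is \<open>2 * L / N\<close>, below
    \<open>r / 2\<close> from here on.\<close>
  obtain N2 :: nat where N2: "real N2 > 4 * real L / r" using reals_Archimedean2 by blast
  show "\<exists>no. \<forall>N\<ge>no. norm ((\<Sum>m<N. g (run \<delta> u q m) (u m)) / real N - 0) < r"
  proof (intro exI allI impI)
    fix N assume N: "N \<ge> max N1 (max N2 1)"
    have "\<bar>\<Sum>m<N. \<Sum>l<L. D (m + l)\<bar> \<le> (\<Sum>m<N. F (map u [m..<m + L]))"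
    proof (rule order.trans[OF sum_abs], rule sum_mono)
      fix m
      have "\<bar>\<Sum>l<L. D (m + l)\<bar> = \<bar>word_sum \<delta> g (map u [m..<m + L]) (run \<delta> u q m)\<bar>"
        by (simp add: word_sum_window D_def)
      also have "\<dots> \<le> F (map u [m..<m + L])"
        unfolding F_def by (rule member_le_sum) (use run_Q \<open>finite Q\<close> in auto)
      finally show "\<bar>\<Sum>l<L. D (m + l)\<bar> \<le> F (map u [m..<m + L])" .
    qed
    also have "\<dots> \<le> K * real p * real N"
      using N1[of N] N by (simp add: field_simps)
    finally have A: "\<bar>\<Sum>m<N. \<Sum>l<L. D (m + l)\<bar> \<le> K * real p * real N" .
    \<comment> \<open>For fixed \<open>l\<close> the inner sum is a shift of the plain sum, so the
      double sum counts every position \<open>L\<close> times up to boundary terms.\<close>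
    have "(\<Sum>m<N. \<Sum>l<L. D (m + l)) - real L * (\<Sum>m<N. D m)
        = (\<Sum>l<L. (\<Sum>m<N. D (m + l)) - (\<Sum>m<N. D m))"
      by (subst sum.swap) (simp add: sum_subtractf)
    also have "\<bar>\<dots>\<bar> \<le> (\<Sum>l<L. 2 * real L)"
      by (rule order.trans[OF sum_abs], rule sum_mono, rule order.trans[OF shifted_sum_diff_le[OF D1]]) simp
    finally have B: "\<bar>(\<Sum>m<N. \<Sum>l<L. D (m + l)) - real L * (\<Sum>m<N. D m)\<bar> \<le> 2 * real L * real L"
      by simp
    have "real L * \<bar>\<Sum>m<N. D m\<bar> = \<bar>real L * (\<Sum>m<N. D m)\<bar>"
      by (simp add: abs_mult)
    also have "\<dots> \<le> K * real p * real N + 2 * real L * real L"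
      using A B by linarith
    also have "\<dots> < real L * (r * real N)"
    proof -
      have "4 * real L < r * real N"
        using N2 N \<open>r > 0\<close> by (simp add: field_simps)
          (smt (verit) mult_left_mono of_nat_le_iff mult.commute)
      then have "real L * (2 * real L) \<le> real L * (r * real N / 2)"
        by (intro mult_left_mono) auto
      moreover have "K * real p * real N < r * real p / 2 * real p * real N"
        using p \<open>r > 0\<close> p0 N by (intro mult_strict_right_mono) (auto simp: field_simps)
      ultimately show ?thesis by (simp add: L_def power2_eq_square algebra_simps)
    qed
    finally have "\<bar>\<Sum>m<N. D m\<bar> < r * real N" using L0 by simp
    then show "norm ((\<Sum>m<N. g (run \<delta> u q m) (u m)) / real N - 0) < r"
      using N by (simp add: D_def field_simps)
  qed
qed

section \<open>The self-selected subsequence\<close>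

text \<open>
  A state \<open>(r, h)\<close> consists of the number \<open>r\<close> of digits still to be skipped and the last (at most
  \<open>k\<close>) selected digits \<open>h\<close>. The arbitrary starting index \<open>n 1\<close> is an initial countdown.
\<close>

definition skip_step :: "nat \<Rightarrow> nat \<times> nat list \<Rightarrow> nat \<Rightarrow> nat \<times> nat list" where
  "skip_step k s d = (case s of (r, h) \<Rightarrow>
     if r > 0 then (r - 1, h) else (d, if length h < k then h @ [d] else tl (h @ [d])))"

lemma skip_step_simps [simp]:
  "skip_step k (Suc r, h) d = (r, h)"
  "skip_step k (0, h) d = (d, if length h < k then h @ [d] else tl (h @ [d]))"
  by (simp_all add: skip_step_def)

text \<open>Countdown 0 means that the digit about to be read is selected. The gain tests whether
  \<open>e\<close> follows the history \<open>c\<close>, centred by \<open>1 / b\<close> to have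
  mean zero over the next digit.\<close>

definition skip_gain :: "nat \<Rightarrow> nat list \<Rightarrow> nat \<Rightarrow> nat \<times> nat list \<Rightarrow> nat \<Rightarrow> real" where
  "skip_gain b c e s d = (if s = (0, c) then of_bool (d = e) - 1 / real b else 0)"

lemma skip_step_countdown:
  assumes "run (skip_step k) u q m = (r, h)" "t \<le> r"
  shows "run (skip_step k) u q (m + t) = (r - t, h)"
  using assms(2) by (induction t) (use assms(1) in \<open>auto simp: skip_step_def\<close>)

text \<open>The states passed have countdowns \<open>r\<close> down to 1, where the gain
  vanishes.\<close>

lemma skip_gain_countdown:
  assumes "run (skip_step k) u q m = (r, h)"
  shows "(\<Sum>j<m + r. skip_gain b c e (run (skip_step k) u q j) (u j))
    = (\<Sum>j<m. skip_gain b c e (run (skip_step k) u q j) (u j))"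
proof -
  have "(\<Sum>j<m + t. skip_gain b c e (run (skip_step k) u q j) (u j))
    = (\<Sum>j<m. skip_gain b c e (run (skip_step k) u q j) (u j))" if "t \<le> r" for t
    using that
    by (induction t) (auto simp: skip_gain_def skip_step_countdown[OF assms])
  then show ?thesis by simp
qed

text \<open>Reading position \<open>p i\<close> sets the countdown to \<open>u (p i)\<close>, which
  runs out exactly at \<open>p (Suc i)\<close>. For \<open>i < k\<close> truncated subtraction makes
  the list the whole history.\<close>

lemma run_skip_step:
  assumes "\<And>i. p (Suc i) = p i + 1 + u (p i)"
  shows "run (skip_step k) u (p 0, []) (p i) = (0, map (\<lambda>i. u (p i)) [i - k..<i])"
proof (induction i)
  case 0
  then show ?case using skip_step_countdown[of k u "(p 0, [])" 0 "p 0" "[]" "p 0"] by simp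
next
  case (Suc i)
  let ?y = "\<lambda>i. u (p i)"
  have "run (skip_step k) u (p 0, []) (p i + 1) = (u (p i), map ?y [Suc i - k..<Suc i])"
  proof (cases "i < k")
    case True
    then show ?thesis using Suc by simp
  next
    case False
    then have "tl (map ?y [i - k..<i] @ [?y i]) = map ?y [Suc i - k..<Suc i]"
      by (cases "k = 0") (auto simp: map_tl tl_append split: list.split simp: upt_conv_Cons Suc_diff_le)
    then show ?thesis using Suc False by simp
  qed
  from skip_step_countdown[OF this, of "u (p i)"] show ?case by (simp add: assms)
qed

lemma sum_skip_gain:
  assumes "\<And>i. p (Suc i) = p i + 1 + u (p i)"
  shows "(\<Sum>j<p M. skip_gain b c e (run (skip_step k) u (p 0, []) j) (u j))
    = (\<Sum>i<M. of_bool (map (\<lambda>i. u (p i)) [i - k..<i] = c) * (of_bool (u (p i) = e) - 1 / real b))"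
proof (induction M)
  case 0
  then show ?case using skip_gain_countdown[of k u "(p 0, [])" 0 "p 0" "[]" b c e] by simp
next
  case (Suc M)
  let ?G = "\<lambda>j. skip_gain b c e (run (skip_step k) u (p 0, []) j) (u j)"
  obtain h where "run (skip_step k) u (p 0, []) (p M + 1) = (u (p M), h)"
    using run_skip_step[of p u k M, OF assms] by auto
  from skip_gain_countdown[OF this] have "(\<Sum>j<p (Suc M). ?G j) = (\<Sum>j<p M + 1. ?G j)"
    by (simp add: assms)
  then show ?case
    using Suc run_skip_step[of p u k M, OF assms] by (simp add: skip_gain_def)
qed

text \<open>The steps of \<open>p\<close> lie between 1 and \<open>b\<close>, so \<open>p M\<close>
  tends to infinity but grows at most linearly. Dividing by \<open>M\<close> instead of
  \<open>p M\<close> therefore preserves the limit 0.\<close>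

lemma skip_centred_average:
  assumes freq: "word_frequencies b u" and u: "\<And>i. u i < b"
    and p: "\<And>i. p (Suc i) = p i + 1 + u (p i)"
    and c: "c \<in> words b k" and e: "e < b"
  shows "(\<lambda>M. (\<Sum>i<M. of_bool (map (\<lambda>i. u (p i)) [i - k..<i] = c)
      * (of_bool (u (p i) = e) - 1 / real b)) / real M) \<longlonglongrightarrow> 0"
proof -
  \<comment> \<open>Countdowns start at \<open>p 0\<close> and are reset to digits below
    \<open>b\<close>, which bounds them and makes \<open>Q\<close> finite.\<close>
  define Q where "Q = {..max b (p 0)} \<times> {h. set h \<subseteq> {..<b} \<and> length h \<le> k}"
  define T where "T N = (\<Sum>j<N. skip_gain b c e (run (skip_step k) u (p 0, []) j) (u j))" for N
  have "(\<lambda>N. T N / real N) \<longlonglongrightarrow> 0"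
    unfolding T_def
  proof (rule centred_automaton_average[OF freq u, of Q])
    show "finite Q" by (auto simp: Q_def intro: finite_lists_length_le)
    show "(p 0, []) \<in> Q" by (auto simp: Q_def)
    show "skip_step k q d \<in> Q" if "q \<in> Q" "d < b" for q d
    proof -
      obtain r h where "q = (r, h)" by fastforce
      moreover have "set (tl (h @ [d])) \<subseteq> insert d (set h)" by (cases h) auto
      ultimately show ?thesis using that by (cases r) (auto simp: Q_def)
    qed
    show "(\<Sum>d<b. skip_gain b c e q d) = 0" for q
      using e by (cases "q = (0, c)") (auto simp: skip_gain_def sum_subtractf of_bool_def)
    show "\<bar>skip_gain b c e q d\<bar> \<le> 1" for q d
      using e by (auto simp: skip_gain_def of_bool_def)
  qed
  moreover have growth: "M \<le> p M \<and> p M \<le> p 0 + b * M" for M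
  proof (induction M)
    case (Suc M)
    then show ?case using u[of "p M"] by (simp add: p)
  qed simp
  moreover have "filterlim p at_top sequentially"
    by (rule filterlim_at_top_mono[OF filterlim_ident]) (use growth in auto)
  ultimately have lim: "(\<lambda>M. T (p M) / real (p M)) \<longlonglongrightarrow> 0"
    using filterlim_compose[of "\<lambda>N. T N / real N"] by blast
  have "(\<lambda>M. T (p M) / real M) \<longlonglongrightarrow> 0"
  proof (rule Lim_null_comparison)
    show "(\<lambda>M. \<bar>T (p M) / real (p M)\<bar> * real (p 0 + b)) \<longlonglongrightarrow> 0"
      by (rule tendsto_mult_left_zero[OF tendsto_rabs_zero[OF lim]])
    show "\<forall>\<^sub>F M in sequentially. norm (T (p M) / real M) \<le> \<bar>T (p M) / real (p M)\<bar> * real (p 0 + b)"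
    proof (rule eventually_sequentiallyI)
      fix M :: nat assume M: "M \<ge> 1"
      have pM: "p M > 0" using growth[of M] M by linarith
      have "p M \<le> (p 0 + b) * M"
        using growth[of M] M by (auto simp: algebra_simps intro: order.trans[OF conjunct2[OF growth]])
      then have "real (p M) \<le> real (p 0 + b) * real M" by (metis of_nat_le_iff of_nat_mult)
      then have "\<bar>T (p M)\<bar> * real (p M) \<le> \<bar>T (p M)\<bar> * (real (p 0 + b) * real M)"
        by (rule mult_left_mono) simp
      then show "norm (T (p M) / real M) \<le> \<bar>T (p M) / real (p M)\<bar> * real (p 0 + b)"
        using M pM by (simp add: field_simps)
    qed
  qed
  then show ?thesis unfolding T_def sum_skip_gain[of p u, OF p] .
qed

text \<open>Induction on the last letter: by the centred average, appending \<open>e\<close> to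
  \<open>c\<close> divides the frequency by \<open>b\<close>.\<close>

lemma word_frequencies_skip:
  assumes freq: "word_frequencies b u" and u: "\<And>i. u i < b"
    and p: "\<And>i. p (Suc i) = p i + 1 + u (p i)"
  shows "word_frequencies b (\<lambda>i. u (p i))"
proof -
  define y where "y i = u (p i)" for i
  have b0: "b > 0" using u[of 0] by simp
  \<comment> \<open>Counted at its end, an occurrence of \<open>c @ [e]\<close> is an occurrence of \<open>c\<close> followed by \<open>e\<close>. For
    \<open>i < length w\<close> the truncated subtraction gives a list that is too short to match.\<close>
  define E where "E w M = (\<Sum>i<M. of_bool (map y [i - length w..<i] = w) :: real)" for w M
  have ends: "(\<lambda>M. E w M / real M) \<longlonglongrightarrow> 1 / real b ^ length w" if "set w \<subseteq> {..<b}" for w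
    using that
  proof (induction w rule: rev_induct)
    case Nil
    show ?case using real_over_self_tendsto_1 by (simp add: E_def)
  next
    case (snoc e c)
    have c: "c \<in> words b (length c)" and e: "e < b" using snoc.prems by (auto simp: words_def)
    have "E (c @ [e]) (Suc M) = (\<Sum>i<M. of_bool (map y [i - length c..<i] = c)
        * (of_bool (y i = e) - 1 / real b)) + E c M / real b" for M
    proof -
      \<comment> \<open>The term at index 0 vanishes because \<open>c @ [e]\<close> is nonempty; the
        others are shifted down by one.\<close>
      have "E (c @ [e]) (Suc M)
          = (\<Sum>i<M. of_bool (map y [i - length c..<i] = c) * of_bool (y i = e))"
        unfolding E_def by (subst sum.lessThan_Suc_shift) (auto intro!: arg_cong[where f = card])
      then show ?thesis
        by (simp add: E_def right_diff_distrib sum_subtractf del: sum_of_bool_eq flip: sum_divide_distrib)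
    qed
    then have "(\<lambda>M. E (c @ [e]) (Suc M) / real M) =
      (\<lambda>M. (\<Sum>i<M. of_bool (map y [i - length c..<i] = c)
        * (of_bool (y i = e) - 1 / real b)) / real M + E c M / real M / real b)"
      by (simp add: add_divide_distrib mult.commute)
    also have "\<dots> \<longlonglongrightarrow> 0 + 1 / real b ^ length c / real b"
    proof (rule tendsto_add)
      show "(\<lambda>M. E c M / real M / real b) \<longlonglongrightarrow> 1 / real b ^ length c / real b"
        by (rule tendsto_divide[OF snoc.IH tendsto_const]) (use snoc.prems b0 in auto)
    qed (unfold y_def, rule skip_centred_average[of b u p, OF freq u p c e])
    finally have "(\<lambda>M. E (c @ [e]) (Suc M) / real M) \<longlonglongrightarrow> 1 / real b ^ length (c @ [e])"
      by (simp add: mult.commute)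
    then have "(\<lambda>M. E (c @ [e]) (Suc M) / real M * (real M / real (Suc M)))
        \<longlonglongrightarrow> 1 / real b ^ length (c @ [e]) * 1"
      by (rule tendsto_mult) (rule LIMSEQ_n_over_Suc_n)
    moreover have "eventually (\<lambda>M. E (c @ [e]) (Suc M) / real M * (real M / real (Suc M))
        = E (c @ [e]) (Suc M) / real (Suc M)) sequentially"
      by (rule eventually_sequentiallyI[of 1]) simp
    ultimately have "(\<lambda>M. E (c @ [e]) (Suc M) / real (Suc M)) \<longlonglongrightarrow> 1 / real b ^ length (c @ [e])"
      using Lim_transform_eventually by fastforce
    then show ?case by (rule LIMSEQ_imp_Suc)
  qed
  show ?thesis
    unfolding word_frequencies_def
  proof (intro allI ballI)
    fix L w assume w: "w \<in> words b L"
    then have len: "length w = L" by (simp add: words_def)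
    \<comment> \<open>An occurrence starting at \<open>m\<close> ends at \<open>m + L\<close>, hence
      the bound \<open>N + L\<close>; the first \<open>L\<close> end positions contribute nothing or
      the range is empty.\<close>
    have "real (card {m. m < N \<and> map y [m..<m + L] = w}) = E w (N + L)" for N
    proof -
      have "E w (N + L) = (\<Sum>i<L. of_bool (map y [i - L..<i] = w)) + (\<Sum>i<N. of_bool (map y [i..<i + L] = w))"
        unfolding E_def len
        using sum.atLeastLessThan_concat[of 0 L "N + L" "\<lambda>i. of_bool (map y [i - L..<i] = w) :: real"]
          sum.shift_bounds_nat_ivl[of "\<lambda>i. of_bool (map y [i - L..<i] = w) :: real" 0 L N]
        by (simp add: lessThan_atLeast0 add.commute)
      also have "(\<Sum>i<L. of_bool (map y [i - L..<i] = w)) = (0 :: real)"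
        using len by (intro sum.neutral) auto
      finally show ?thesis
        by (simp add: of_bool_def sum.If_cases Collect_conj_eq lessThan_def)
    qed
    moreover have "(\<lambda>N. E w (N + L) / real N) \<longlonglongrightarrow> 1 / real b ^ L"
    proof -
      have "(\<lambda>N. E w (N + L) / real (N + L)) \<longlonglongrightarrow> 1 / real b ^ L"
        using LIMSEQ_ignore_initial_segment[OF ends[of w], of L] w by (simp add: words_def)
      moreover have "(\<lambda>N. 1 + real L / real N) \<longlonglongrightarrow> 1 + 0"
        by (intro tendsto_add tendsto_const lim_const_over_n)
      ultimately have "(\<lambda>N. E w (N + L) / real (N + L) * (1 + real L / real N)) \<longlonglongrightarrow> 1 / real b ^ L * (1 + 0)"
        by (rule tendsto_mult)
      moreover have "eventually (\<lambda>N. E w (N + L) / real (N + L) * (1 + real L / real N)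
          = E w (N + L) / real N) sequentially"
      proof (rule eventually_sequentiallyI[of 1])
        fix N :: nat assume "N \<ge> 1"
        then have "1 + real L / real N = real (N + L) / real N" by (simp add: field_simps)
        then show "E w (N + L) / real (N + L) * (1 + real L / real N) = E w (N + L) / real N"
          using \<open>N \<ge> 1\<close> by simp
      qed
      ultimately show ?thesis using Lim_transform_eventually by fastforce
    qed
    ultimately show "(\<lambda>N. real (card {m. m < N \<and> map (\<lambda>i. u (p i)) [m..<m + L] = w}) / real N)
        \<longlonglongrightarrow> 1 / real b ^ L"
      by (simp flip: y_def)
  qed
qed

theorem theorem1p1:
  fixes b :: nat and x :: real and a n :: "nat \<Rightarrow> nat"
  assumes "b \<ge> 2"
    and "digit_seq b a"
    and "x = radix_value b a"
    and "normal_to_base b x"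
    and "n 1 \<ge> 1"
    and "\<And>i. i \<ge> 1 \<Longrightarrow> n (i + 1) = n i + 1 + a (n i)"
  shows "normal_to_base b (radix_value b (\<lambda>i. a (n i)))"
proof -
  \<comment> \<open>Normality of \<open>x\<close> yields only some normal expansion
    \<open>d\<close>; uniqueness then identifies its digits with those of \<open>a\<close>.\<close>
  obtain d where d: "digit_seq b d" "radix_value b a = radix_value b d" "normal_digits b d"
    using assms(3,4) by (auto simp: normal_to_base_def)
  define u where "u i = a (Suc i)" for i
  \<comment> \<open>Shifts the selected positions to indexing from 0. The subtraction is exact
    because every \<open>n (Suc i)\<close> is at least 1.\<close>
  define p where "p i = n (Suc i) - 1" for i
  have "u = (\<lambda>i. d (Suc i))"
    using normal_expansion_unique[OF assms(1,2) d(1,3,2)] by (intro ext) (simp add: u_def)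
  then have freq: "word_frequencies b u"
    using d(3) by (simp add: normal_digits_iff_word_frequencies)
  have u: "u i < b" for i using assms(2) by (simp add: u_def digit_seq_def)
  have n_pos: "n (Suc i) \<ge> 1" for i
    by (induction i) (use assms(5,6) in auto)
  have u_p: "u (p i) = a (n (Suc i))" for i
    using n_pos[of i] by (simp add: u_def p_def)
  have "p (Suc i) = p i + 1 + u (p i)" for i
    using assms(6)[of "Suc i"] n_pos[of i] u_p[of i] by (simp add: p_def)
  from word_frequencies_skip[of b u p, OF freq u this]
  have "normal_digits b (\<lambda>i. a (n i))"
    by (simp add: normal_digits_iff_word_frequencies u_p)
  moreover have "digit_seq b (\<lambda>i. a (n i))"
    unfolding digit_seq_def
  proof (intro allI impI)
    fix j :: nat assume "j \<ge> 1"
    then show "a (n j) < b"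
      using n_pos[of "j - 1"] assms(2) by (simp add: digit_seq_def)
  qed
  ultimately show ?thesis by (auto simp: normal_to_base_def)
qed

end
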